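(* Let $\Omega_u\subset\mathbb R$ be an open interval, $f:\Omega_u\to\mathbb R^2$ and $D:\Omega_u\to(0,\infty)$ smooth, and set $\tau(u)=3D(u)$. Let $\xi_1=(0,0)^T$, $\xi_2=-\xi_4=(1,0)^T$, $\xi_3=-\xi_5=(0,1)^T$, $\omega_1=\frac13$, $\omega_2=\omega_3=\omega_4=\omega_5=\frac16$. Consider the lattice Boltzmann model $$\partial_tg_i+\frac1\varepsilon\xi_i\cdot\nabla g_i=\frac1{\varepsilon^2}\frac1{\tau(u)}\big(g_i^{(eq)}-g_i\big),\quad i=1,\dots,5,\qquad g_i^{(eq)}=\omega_iu+3\varepsilon\,\omega_i\,\xi_i\cdot f(u),\quad u=\sum_{i=1}^5g_i,$$ for scalar functions $g_i(x,t)$, $x\in\mathbb R^2$. In the variables $u$ and $w=(h_2,h_3,h_4,h_5)^T$, $h_i=g_i-\omega_iu$, it is equivalent to $$\begin{aligned} &\partial_tu+\frac1\varepsilon\nabla\cdot\Big(\sum_{k=2}^5\xi_kh_k\Big)=0, \\ &\partial_th_i+\frac1\varepsilon\nabla\cdot\Big(\xi_ih_i+\omega_i\xi_iu-\omega_i\sum_{k=2}^5\xi_kh_k\Big)=\frac1{\varepsilon^2}\frac1{\tau(u)}\big(3\varepsilon\,\omega_i\,\xi_i\cdot f(u)-h_i\big),\quad i=2,\dots,5.\end{aligned}$$ Then this system for $U=(u,w)^T$ satisfies the convergence criteria (i)-(v) listed in the context, and its limit equation (as defined in the context) is the convection-diffusion equation $\partial_tu+\nabla\cdot f(u)=\nabla\cdot(D(u)\nabla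 u)$ in two space dimensions.
   Context: Convergence criteria. Let $\partial_tU+\frac1\varepsilon\sum_{j=1}^dA_j(U;\varepsilon)\partial_{x_j}U=\frac1{\varepsilon^2}Q(U;\varepsilon)$ be a first-order system for $U=(u,w)^T\in\Omega\subset\mathbb R^n$, $u\in\mathbb R^{n-r}$, $w\in\mathbb R^r$, with parameter $\varepsilon\in(0,1]$; $A_j$ and $Q$ are smooth in $(U;\varepsilon)$, up to $\varepsilon=0$. $\Omega_u\subset\mathbb R^{n-r}$ is an open convex set (the state space of $u$), $\Omega$ is open, $(u,w)\in\Omega$ implies $u\in\Omega_u$, and $(u,0)\in\Omega$ for $u\in\Omega_u$. An $n\times n$ matrix $A$ is partitioned as $\begin{pmatrix} A^{11} & A^{12} \\ A^{21} & A^{22} \end{pmatrix}$ according to $n=(n-r)+r$. The criteria are: (i) $Q(U;\varepsilon)=(0,q(U;\varepsilon))^T$ with $q$ a smooth $\mathbb R^r$-valued function. (ii) $q(u,w;0)=0$ if and only if $w=0$, and $\partial_wq(u,0;0)$ is invertible for all $u\in\Omega_u$. (iii) There is a symmetric positive definite matrix $A_0(U;\varepsilon)$ (symmetrizer) such that $A_0(U;\varepsilon)A_j(U;\varepsilon)=A_j(U;\varepsilon)^TA_0(U;\varepsilon)$ for all $U\in\Omega$ and all $j$. (iv) With this $A_0$, there is a symmetric positive definite $r\times r$ matrix $S(u)$ such that $A_0(u,0;0)\,\partial_UQ(u,0;0)+(\partial_UQ(u,0;0))^TA_0(u,0;0)\le-\begin{pmatrix} 0 & 0 \\ 0 & S(u)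 \end{pmatrix}$ for all $u\in\Omega_u$. (v) $A_j^{11}(u,0;0)=0$ and $\partial_uA_j^{11}(u,0;0)=0$ for all $u\in\Omega_u$ and all $j$. Limit equation. This is the equation for the leading term $u_0$ in the formal expansion $u\sim u_0+\varepsilon u_1+\cdots$, $w\sim w_0+\varepsilon w_1+\cdots$; explicitly $w_0=0$, $w_1=\partial_wq(u_0,0;0)^{-1}\big[\sum_jA_j^{21}(u_0,0;0)\partial_{x_j}u_0-\partial_\varepsilon q(u_0,0;0)\big]$ and $$\partial_tu_0+\sum_jA_j^{12}(u_0,0;0)\partial_{x_j}w_1+\sum_j\big(\partial_wA_j^{11}(u_0,0;0)[w_1]\big)\partial_{x_j}u_0+\sum_j\partial_\varepsilon A_j^{11}(u_0,0;0)\partial_{x_j}u_0=0.$$ For the system in the claim, $d=2$, $n=5$, $r=4$. *)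

theory Defs
  imports "HOL-Analysis.Analysis"
begin

section \<open>Smoothness\<close>

text \<open>
  Derivatives are taken relative to the set, so the notion makes sense on sets such as
  \<open>\<Omega> \<times> [0,1]\<close> (one-sided in the last variable), where derivatives are still unique.
  Directional components \<open>f' x v\<close> are used instead of \<open>f' x\<close> itself to avoid function spaces;
  in finite dimension this is the same thing.
\<close>

primrec Ck_on ::
  "nat \<Rightarrow> 'a::real_normed_vector set \<Rightarrow> ('a \<Rightarrow> 'b::real_normed_vector) \<Rightarrow> bool" where
  "Ck_on 0 S f \<longleftrightarrow> continuous_on S f"
| "Ck_on (Suc k) S f \<longleftrightarrow>
     (\<exists>f'. (\<forall>x\<in>S. (f has_derivative f' x) (at x within S)) \<and> (\<forall>v. Ck_on k S (\<lambda>x. f' x v)))"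

definition smooth_on :: "'a::real_normed_vector set \<Rightarrow> ('a \<Rightarrow> 'b::real_normed_vector) \<Rightarrow> bool" where
  "smooth_on S f \<longleftrightarrow> (\<forall>k. Ck_on k S f)"

section \<open>Partial derivatives\<close>

text \<open>Functions of space and time have the form \<open>F x t\<close>; space operators act on \<open>\<lambda>x. F x t\<close>.\<close>

definition dx :: "'d::finite \<Rightarrow> (real^'d \<Rightarrow> 'b::real_normed_vector) \<Rightarrow> real^'d \<Rightarrow> 'b" where
  "dx j F x = vector_derivative (\<lambda>s. F (x + s *\<^sub>R axis j 1)) (at 0)"

definition dt :: "('x \<Rightarrow> real \<Rightarrow> 'b::real_normed_vector) \<Rightarrow> 'x \<Rightarrow> real \<Rightarrow> 'b" where
  "dt F x t = vector_derivative (F x) (at t)"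

definition grad :: "(real^'d \<Rightarrow> real) \<Rightarrow> real^'d \<Rightarrow> real^'d" where
  "grad F x = (\<chi> j. dx j F x)"

definition div_op :: "(real^'d \<Rightarrow> real^'d) \<Rightarrow> real^'d \<Rightarrow> real" where
  "div_op F x = (\<Sum>j\<in>UNIV. dx j (\<lambda>y. F y $ j) x)"

section \<open>Vectors and matrices partitioned as \<open>n = (n - r) + r\<close>\<close>

text \<open>
  \<open>u\<close> is indexed by \<open>'m\<close> (with \<open>CARD('m) = n - r\<close>), \<open>w\<close> by \<open>'r\<close> (with \<open>CARD('r) = r\<close>) and
  \<open>U = (u,w)\<close> by the sum type \<open>'m + 'r\<close>, whose cardinality is \<open>n\<close>.
\<close>

definition join :: "real^'m \<Rightarrow> real^'r \<Rightarrow> real^('m + 'r)" where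
  "join u w = (\<chi> a. case a of Inl i \<Rightarrow> u $ i | Inr k \<Rightarrow> w $ k)"

definition u_part :: "real^('m + 'r::finite) \<Rightarrow> real^'m" where
  "u_part U = (\<chi> i. U $ Inl i)"

definition w_part :: "real^('m::finite + 'r) \<Rightarrow> real^'r" where
  "w_part U = (\<chi> k. U $ Inr k)"

definition blk11 :: "real^('m + 'r::finite)^('m + 'r) \<Rightarrow> real^'m^'m" where
  "blk11 M = (\<chi> i i'. M $ Inl i $ Inl i')"

definition blk12 :: "real^('m + 'r)^('m + 'r) \<Rightarrow> real^'r^'m" where
  "blk12 M = (\<chi> i k. M $ Inl i $ Inr k)"

definition blk21 :: "real^('m + 'r)^('m + 'r) \<Rightarrow> real^'m^'r" where
  "blk21 M = (\<chi> k i. M $ Inr k $ Inl i)"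

definition block_matrix ::
  "real^'m^'m \<Rightarrow> real^'r^'m \<Rightarrow> real^'m^'r \<Rightarrow> real^'r^'r \<Rightarrow> real^('m + 'r)^('m + 'r)" where
  "block_matrix M11 M12 M21 M22 =
     (\<chi> a b. case a of
         Inl i \<Rightarrow> (case b of Inl i' \<Rightarrow> M11 $ i $ i' | Inr k' \<Rightarrow> M12 $ i $ k')
       | Inr k \<Rightarrow> (case b of Inl i' \<Rightarrow> M21 $ k $ i' | Inr k' \<Rightarrow> M22 $ k $ k'))"

definition sym_pos_def :: "real^'n^'n \<Rightarrow> bool" where
  "sym_pos_def M \<longleftrightarrow> transpose M = M \<and> (\<forall>v. v \<noteq> 0 \<longrightarrow> 0 < v \<bullet> (M *v v))"

definition quadratic_form_le :: "real^'n^'n \<Rightarrow> real^'n^'n \<Rightarrow> bool" where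
  "quadratic_form_le M N \<longleftrightarrow> (\<forall>v. v \<bullet> (M *v v) \<le> v \<bullet> (N *v v))"

section \<open>Convergence criteria\<close>

text \<open>
  The system is given by \<open>A j U \<epsilon>\<close> and \<open>Q U \<epsilon>\<close>, where \<open>\<epsilon>\<close> ranges over \<open>[0,1]\<close>
  (\<open>\<epsilon> = 0\<close> is included because \<open>A\<close> and \<open>Q\<close> are smooth up to \<open>\<epsilon> = 0\<close>).
\<close>

definition relaxation_system ::
  "('d::finite \<Rightarrow> real^'n \<Rightarrow> real \<Rightarrow> real^'n^'n) \<Rightarrow> (real^'n \<Rightarrow> real \<Rightarrow> real^'n) \<Rightarrow>
   real \<Rightarrow> (real^'d \<Rightarrow> real \<Rightarrow> real^'n) \<Rightarrow> real^'d \<Rightarrow> real \<Rightarrow> bool" where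
  "relaxation_system A Q \<epsilon> U x t \<longleftrightarrow>
     dt U x t + (1 / \<epsilon>) *\<^sub>R (\<Sum>j\<in>UNIV. A j (U x t) \<epsilon> *v dx j (\<lambda>y. U y t) x)
       = (1 / \<epsilon>\<^sup>2) *\<^sub>R Q (U x t) \<epsilon>"

definition admissible_setting ::
  "(real^'m) set \<Rightarrow> (real^('m + 'r::finite)) set \<Rightarrow>
   ('d::finite \<Rightarrow> real^('m + 'r) \<Rightarrow> real \<Rightarrow> real^('m + 'r)^('m + 'r)) \<Rightarrow>
   (real^('m + 'r) \<Rightarrow> real \<Rightarrow> real^('m + 'r)) \<Rightarrow> bool" where
  "admissible_setting \<Omega>u \<Omega> A Q \<longleftrightarrow>
     open \<Omega>u \<and> convex \<Omega>u \<and> open \<Omega> \<and>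
     (\<forall>u w. join u w \<in> \<Omega> \<longrightarrow> u \<in> \<Omega>u) \<and> (\<forall>u\<in>\<Omega>u. join u 0 \<in> \<Omega>) \<and>
     (\<forall>j. smooth_on (\<Omega> \<times> {0..1}) (\<lambda>(U, \<epsilon>). A j U \<epsilon>)) \<and>
     smooth_on (\<Omega> \<times> {0..1}) (\<lambda>(U, \<epsilon>). Q U \<epsilon>)"

definition q_of :: "(real^('m::finite + 'r) \<Rightarrow> real \<Rightarrow> real^('m + 'r)) \<Rightarrow> real^('m + 'r) \<Rightarrow> real \<Rightarrow> real^'r" where
  "q_of Q U \<epsilon> = w_part (Q U \<epsilon>)"

definition dw_q :: "(real^('m + 'r) \<Rightarrow> real \<Rightarrow> real^('m + 'r)) \<Rightarrow> real^'m \<Rightarrow> real^'r^'r" where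
  "dw_q Q u = matrix (frechet_derivative (\<lambda>w. q_of Q (join u w) 0) (at 0))"

definition dU_Q ::
  "(real^('m + 'r::finite) \<Rightarrow> real \<Rightarrow> real^('m + 'r)) \<Rightarrow> real^'m \<Rightarrow> real^('m + 'r)^('m + 'r)" where
  "dU_Q Q u = matrix (frechet_derivative (\<lambda>U. Q U 0) (at (join u 0)))"

definition criterion_i ::
  "(real^('m::finite + 'r::finite)) set \<Rightarrow> (real^('m + 'r) \<Rightarrow> real \<Rightarrow> real^('m + 'r)) \<Rightarrow> bool" where
  "criterion_i \<Omega> Q \<longleftrightarrow>
     (\<forall>U\<in>\<Omega>. \<forall>\<epsilon>\<in>{0..1}. Q U \<epsilon> = join 0 (q_of Q U \<epsilon>)) \<and>
     smooth_on (\<Omega> \<times> {0..1}) (\<lambda>(U, \<epsilon>). q_of Q U \<epsilon>)"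

definition criterion_ii ::
  "(real^'m) set \<Rightarrow> (real^('m + 'r::finite)) set \<Rightarrow> (real^('m + 'r) \<Rightarrow> real \<Rightarrow> real^('m + 'r)) \<Rightarrow> bool" where
  "criterion_ii \<Omega>u \<Omega> Q \<longleftrightarrow>
     (\<forall>u w. join u w \<in> \<Omega> \<longrightarrow> (q_of Q (join u w) 0 = 0 \<longleftrightarrow> w = 0)) \<and>
     (\<forall>u\<in>\<Omega>u. invertible (dw_q Q u))"

definition criterion_iii ::
  "(real^'n) set \<Rightarrow> ('d::finite \<Rightarrow> real^'n \<Rightarrow> real \<Rightarrow> real^'n^'n) \<Rightarrow>
   (real^'n \<Rightarrow> real \<Rightarrow> real^'n^'n) \<Rightarrow> bool" where
  "criterion_iii \<Omega> A A0 \<longleftrightarrow>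
     (\<forall>U\<in>\<Omega>. \<forall>\<epsilon>\<in>{0..1}. sym_pos_def (A0 U \<epsilon>) \<and>
        (\<forall>j. A0 U \<epsilon> ** A j U \<epsilon> = transpose (A j U \<epsilon>) ** A0 U \<epsilon>))"

definition criterion_iv ::
  "(real^'m) set \<Rightarrow> (real^('m + 'r::finite) \<Rightarrow> real \<Rightarrow> real^('m + 'r)) \<Rightarrow>
   (real^('m + 'r) \<Rightarrow> real \<Rightarrow> real^('m + 'r)^('m + 'r)) \<Rightarrow> bool" where
  "criterion_iv \<Omega>u Q A0 \<longleftrightarrow>
     (\<exists>S. \<forall>u\<in>\<Omega>u. sym_pos_def (S u) \<and>
        quadratic_form_le
          (A0 (join u 0) 0 ** dU_Q Q u + transpose (dU_Q Q u) ** A0 (join u 0) 0)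
          (- block_matrix 0 0 0 (S u)))"

definition criterion_v ::
  "(real^'m) set \<Rightarrow>
   ('d::finite \<Rightarrow> real^('m + 'r::finite) \<Rightarrow> real \<Rightarrow> real^('m + 'r)^('m + 'r)) \<Rightarrow> bool" where
  "criterion_v \<Omega>u A \<longleftrightarrow>
     (\<forall>u\<in>\<Omega>u. \<forall>j. blk11 (A j (join u 0) 0) = 0 \<and>
        ((\<lambda>u'. blk11 (A j (join u' 0) 0)) has_derivative (\<lambda>_. 0)) (at u))"

definition convergence_criteria ::
  "(real^'m) set \<Rightarrow> (real^('m + 'r::finite)) set \<Rightarrow>
   ('d::finite \<Rightarrow> real^('m + 'r) \<Rightarrow> real \<Rightarrow> real^('m + 'r)^('m + 'r)) \<Rightarrow>
   (real^('m + 'r) \<Rightarrow> real \<Rightarrow> real^('m + 'r)) \<Rightarrow> bool" where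
  "convergence_criteria \<Omega>u \<Omega> A Q \<longleftrightarrow>
     criterion_i \<Omega> Q \<and> criterion_ii \<Omega>u \<Omega> Q \<and>
     (\<exists>A0. criterion_iii \<Omega> A A0 \<and> criterion_iv \<Omega>u Q A0) \<and>
     criterion_v \<Omega>u A"

section \<open>Limit equation\<close>

definition deps_q :: "(real^('m + 'r) \<Rightarrow> real \<Rightarrow> real^('m + 'r)) \<Rightarrow> real^'m \<Rightarrow> real^'r" where
  "deps_q Q u = vector_derivative (\<lambda>\<epsilon>. q_of Q (join u 0) \<epsilon>) (at 0 within {0..1})"

definition dw_A11 ::
  "(real^('m + 'r) \<Rightarrow> real \<Rightarrow> real^('m + 'r)^('m + 'r)) \<Rightarrow> real^'m \<Rightarrow> real^'r \<Rightarrow> real^'m^'m" where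
  "dw_A11 Aj u = frechet_derivative (\<lambda>w. blk11 (Aj (join u w) 0)) (at 0)"

definition deps_A11 ::
  "(real^('m + 'r::finite) \<Rightarrow> real \<Rightarrow> real^('m + 'r)^('m + 'r)) \<Rightarrow> real^'m \<Rightarrow> real^'m^'m" where
  "deps_A11 Aj u = vector_derivative (\<lambda>\<epsilon>. blk11 (Aj (join u 0) \<epsilon>)) (at 0 within {0..1})"

definition limit_w1 ::
  "('d::finite \<Rightarrow> real^('m + 'r) \<Rightarrow> real \<Rightarrow> real^('m + 'r)^('m + 'r)) \<Rightarrow>
   (real^('m + 'r) \<Rightarrow> real \<Rightarrow> real^('m + 'r)) \<Rightarrow>
   (real^'d \<Rightarrow> real \<Rightarrow> real^'m) \<Rightarrow> real^'d \<Rightarrow> real \<Rightarrow> real^'r" where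
  "limit_w1 A Q u0 x t =
     matrix_inv (dw_q Q (u0 x t)) *v
       ((\<Sum>j\<in>UNIV. blk21 (A j (join (u0 x t) 0) 0) *v dx j (\<lambda>y. u0 y t) x) - deps_q Q (u0 x t))"

definition limit_equation ::
  "('d::finite \<Rightarrow> real^('m + 'r::finite) \<Rightarrow> real \<Rightarrow> real^('m + 'r)^('m + 'r)) \<Rightarrow>
   (real^('m + 'r) \<Rightarrow> real \<Rightarrow> real^('m + 'r)) \<Rightarrow>
   (real^'d \<Rightarrow> real \<Rightarrow> real^'m) \<Rightarrow> real^'d \<Rightarrow> real \<Rightarrow> bool" where
  "limit_equation A Q u0 x t \<longleftrightarrow>
     dt u0 x t
     + (\<Sum>j\<in>UNIV. blk12 (A j (join (u0 x t) 0) 0) *v dx j (\<lambda>y. limit_w1 A Q u0 y t) x)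
     + (\<Sum>j\<in>UNIV. dw_A11 (A j) (u0 x t) (limit_w1 A Q u0 x t) *v dx j (\<lambda>y. u0 y t) x)
     + (\<Sum>j\<in>UNIV. deps_A11 (A j) (u0 x t) *v dx j (\<lambda>y. u0 y t) x) = 0"

section \<open>The D2Q5 lattice Boltzmann model\<close>

text \<open>
  The five populations are indexed by the type \<open>5\<close>, with elements \<open>1, 2, 3, 4, 5\<close> (where \<open>5 = 0\<close>).
  The components of \<open>w = (h\<^sub>2, h\<^sub>3, h\<^sub>4, h\<^sub>5)\<close> are indexed by the type \<open>4\<close>; component \<open>k\<close>
  is \<open>h\<close> with index \<open>dir k\<close>.
\<close>

definition dir :: "4 \<Rightarrow> 5" where
  "dir k = (if k = 1 then 2 else if k = 2 then 3 else if k = 3 then 4 else 5)"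

definition xi :: "5 \<Rightarrow> real^2" where
  "xi i = (if i = 2 then vector [1, 0] else if i = 3 then vector [0, 1]
           else if i = 4 then - vector [1, 0] else if i = 5 then - vector [0, 1] else 0)"

definition omega :: "5 \<Rightarrow> real" where
  "omega i = (if i = 1 then 1/3 else 1/6)"

definition lb_equation ::
  "(real \<Rightarrow> real) \<Rightarrow> (real \<Rightarrow> real^2) \<Rightarrow> real \<Rightarrow> (real^2 \<Rightarrow> real \<Rightarrow> real^5) \<Rightarrow> real^2 \<Rightarrow> real \<Rightarrow> bool" where
  "lb_equation \<tau> f \<epsilon> g x t \<longleftrightarrow>
     (let u = (\<Sum>i\<in>UNIV. g x t $ i);
          geq = (\<lambda>i. omega i * u + 3 * \<epsilon> * omega i * (xi i \<bullet> f u))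
      in \<forall>i. dt (\<lambda>x t. g x t $ i) x t + 1 / \<epsilon> * (xi i \<bullet> grad (\<lambda>y. g y t $ i) x)
             = 1 / \<epsilon>\<^sup>2 * (1 / \<tau> u) * (geq i - g x t $ i))"

definition lb_vars :: "real^5 \<Rightarrow> real^(1 + 4)" where
  "lb_vars g = (let u = (\<Sum>i\<in>UNIV. g $ i)
                in join (vec u) (\<chi> k. g $ dir k - omega (dir k) * u))"

definition lb_uh_equations ::
  "(real \<Rightarrow> real) \<Rightarrow> (real \<Rightarrow> real^2) \<Rightarrow> real \<Rightarrow>
   (real^2 \<Rightarrow> real \<Rightarrow> real^(1 + 4)) \<Rightarrow> real^2 \<Rightarrow> real \<Rightarrow> bool" where
  "lb_uh_equations \<tau> f \<epsilon> U x t \<longleftrightarrow>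
     (let u = (\<lambda>x t. U x t $ Inl 1);
          h = (\<lambda>k x t. U x t $ Inr k);
          m = (\<lambda>x t. \<Sum>k\<in>UNIV. h k x t *\<^sub>R xi (dir k))
      in dt u x t + 1 / \<epsilon> * div_op (\<lambda>y. m y t) x = 0 \<and>
         (\<forall>k. dt (h k) x t
              + 1 / \<epsilon> * div_op (\<lambda>y. h k y t *\<^sub>R xi (dir k)
                                  + (omega (dir k) * u y t) *\<^sub>R xi (dir k)
                                  - omega (dir k) *\<^sub>R m y t) x
              = 1 / \<epsilon>\<^sup>2 * (1 / \<tau> (u x t)) *
                  (3 * \<epsilon> * omega (dir k) * (xi (dir k) \<bullet> f (u x t)) - h k x t)))"

text \<open>The coefficients of the previous equations in the form of \<^const>\<open>relaxation_system\<close>.\<close>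

definition lb_A :: "2 \<Rightarrow> real^(1 + 4) \<Rightarrow> real \<Rightarrow> real^(1 + 4)^(1 + 4)" where
  "lb_A j U \<epsilon> = block_matrix 0 (\<chi> i k. xi (dir k) $ j) (\<chi> k i. omega (dir k) * xi (dir k) $ j)
     (\<chi> k l. (if k = l then xi (dir k) $ j else 0) - omega (dir k) * xi (dir l) $ j)"

definition lb_Q ::
  "(real \<Rightarrow> real) \<Rightarrow> (real \<Rightarrow> real^2) \<Rightarrow> real^(1 + 4) \<Rightarrow> real \<Rightarrow> real^(1 + 4)" where
  "lb_Q \<tau> f U \<epsilon> =
     (let u = U $ Inl 1
      in join 0 (\<chi> k. 1 / \<tau> u * (3 * \<epsilon> * omega (dir k) * (xi (dir k) \<bullet> f u) - U $ Inr k)))"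

definition convection_diffusion ::
  "(real \<Rightarrow> real^'d) \<Rightarrow> (real \<Rightarrow> real) \<Rightarrow> (real^'d \<Rightarrow> real \<Rightarrow> real) \<Rightarrow> real^'d \<Rightarrow> real \<Rightarrow> bool" where
  "convection_diffusion f D u x t \<longleftrightarrow>
     dt u x t + div_op (\<lambda>y. f (u y t)) x
       = div_op (\<lambda>y. D (u y t) *\<^sub>R grad (\<lambda>z. u z t) y) x"

end

(*
  In the populations g the transport part is diagonal, so the energy sum g_i^2 / omega_i symmetrizes
  it; the source relaxes h at the single rate 1 / tau(u), hence dissipates this energy. In the limit
  w_1 has the components h_k = (1/2) xi_k . (f(u) - D(u) grad u), and the isotropy
  sum_k xi_k xi_k^T = 2 Id turns its transport term into the divergence of f(u) - D(u) grad u.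
*)

theory Submission
  imports Defs
begin

section \<open>Calculus of continuously differentiable functions relative to a set\<close>

text \<open>The criteria ask for smoothness up to \<open>\<epsilon> = 0\<close>, on a set that is
  not open, so smoothness of the source has to be built from closure rules for derivatives relative
  to a set. The only nonlinear ingredients are \<open>f(u)\<close> and \<open>1 / \<tau>(u)\<close>,
  with \<open>u\<close> a coordinate of \<open>U\<close>; sums, bilinear products, reciprocals and
  composition with linear maps on the inside therefore suffice. The matrices \<open>lb_A j\<close>
  depend neither on \<open>U\<close> nor on \<open>\<epsilon>\<close> and have zero 11 block. Hence
  (v) is immediate, and of the limit equation only the time derivative and the 12 block survive. The
  choice \<tau> = 3 D comes from the weight 1/6: the 21 block gives (1/6) xi_k . grad u, the
  \<epsilon>-derivative of q at w = 0 is (1/\<tau>) (3/6) xi_k . f, and the inverse of the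
  w-derivative of q is -\<tau>. So w_1 has the components (1/2) xi_k . f - (\<tau>/6) xi_k . grad u,
  and \<tau>/6 = D/2. The factor 3 in the equilibrium is what gives f the same prefactor
  1/2.\<close>

lemma Ck_on_Suc_imp_Ck_on: "Ck_on (Suc k) S f \<Longrightarrow> Ck_on k S f"
proof (induction k arbitrary: f)
  case 0
  then obtain f' where "\<forall>x\<in>S. (f has_derivative f' x) (at x within S)"
    unfolding Ck_on.simps(2) by blast
  then show ?case
    using has_derivative_continuous_on[of S f f'] by simp
next
  case (Suc k)
  from Suc.prems obtain f' where "\<forall>x\<in>S. (f has_derivative f' x) (at x within S)"
    and "\<forall>v. Ck_on (Suc k) S (\<lambda>x. f' x v)"
    unfolding Ck_on.simps(2) by blast
  with Suc.IH show ?case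
    unfolding Ck_on.simps(2)[of k] by blast
qed

lemma Ck_on_SucI:
  assumes "\<And>x. x \<in> S \<Longrightarrow> (f has_derivative f' x) (at x within S)"
    and "\<And>v. Ck_on k S (\<lambda>x. f' x v)"
  shows "Ck_on (Suc k) S f"
  unfolding Ck_on.simps(2) using assms by blast

lemma Ck_on_SucE:
  assumes "Ck_on (Suc k) S f"
  obtains f' where "\<forall>x\<in>S. (f has_derivative f' x) (at x within S)"
    and "\<forall>v. Ck_on k S (\<lambda>x. f' x v)"
  using assms unfolding Ck_on.simps(2) by blast

lemma Ck_on_const: "Ck_on k S (\<lambda>x. c)"
proof (induction k arbitrary: c)
  case (Suc k)
  show ?case
    by (rule Ck_on_SucI[where f' = "\<lambda>x v. 0"]) (simp_all add: Suc.IH)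
qed simp

lemma Ck_on_bounded_linear:
  assumes L: "bounded_linear L" and "Ck_on k S f"
  shows "Ck_on k S (\<lambda>x. L (f x))"
  using assms(2)
proof (induction k arbitrary: f)
  case 0
  then show ?case
    by (simp add: bounded_linear.continuous_on[OF L])
next
  case (Suc k)
  from Suc.prems obtain f' where f': "\<forall>x\<in>S. (f has_derivative f' x) (at x within S)"
    and "\<forall>v. Ck_on k S (\<lambda>x. f' x v)"
    by (elim Ck_on_SucE)
  with Suc.IH have "Ck_on k S (\<lambda>x. L (f' x v))" for v
    by blast
  with f' bounded_linear.has_derivative[OF L] show ?case
    by (intro Ck_on_SucI[where f' = "\<lambda>x v. L (f' x v)"]) auto
qed

lemma Ck_on_add:
  assumes "Ck_on k S f" and "Ck_on k S g"
  shows "Ck_on k S (\<lambda>x. f x + g x)"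
  using assms
proof (induction k arbitrary: f g)
  case 0
  then show ?case
    by (auto intro: continuous_on_add)
next
  case (Suc k)
  from Suc.prems(1) obtain f' where f': "\<forall>x\<in>S. (f has_derivative f' x) (at x within S)"
    and "\<forall>v. Ck_on k S (\<lambda>x. f' x v)"
    by (elim Ck_on_SucE)
  moreover from Suc.prems(2) obtain g'
    where g': "\<forall>x\<in>S. (g has_derivative g' x) (at x within S)"
    and "\<forall>v. Ck_on k S (\<lambda>x. g' x v)"
    by (elim Ck_on_SucE)
  ultimately have "Ck_on k S (\<lambda>x. f' x v + g' x v)" for v
    using Suc.IH by blast
  with f' g' show ?case
    by (intro Ck_on_SucI[where f' = "\<lambda>x v. f' x v + g' x v"]) (auto intro: has_derivative_add)
qed

text \<open>Each summand of the product rule keeps one factor undifferentiated. That factor is known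
  at order \<open>Suc k\<close> while the induction hypothesis needs order \<open>k\<close>, hence
  the lowering of the order in \<open>fg\<close>.\<close>

lemma Ck_on_bounded_bilinear:
  assumes B: "bounded_bilinear B" and "Ck_on k S f" and "Ck_on k S g"
  shows "Ck_on k S (\<lambda>x. B (f x) (g x))"
  using assms(2,3)
proof (induction k arbitrary: f g)
  case 0
  then show ?case
    by (simp add: bounded_bilinear.continuous_on[OF B])
next
  case (Suc k)
  note fg = Suc.prems[THEN Ck_on_Suc_imp_Ck_on]
  from Suc.prems(1) obtain f' where f': "\<forall>x\<in>S. (f has_derivative f' x) (at x within S)"
    and Cf': "\<forall>v. Ck_on k S (\<lambda>x. f' x v)"
    by (elim Ck_on_SucE)
  from Suc.prems(2) obtain g' where g': "\<forall>x\<in>S. (g has_derivative g' x) (at x within S)"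
    and Cg': "\<forall>v. Ck_on k S (\<lambda>x. g' x v)"
    by (elim Ck_on_SucE)
  have "Ck_on k S (\<lambda>x. B (f x) (g' x v) + B (f' x v) (g x))" for v
    by (intro Ck_on_add Suc.IH fg Cf'[rule_format] Cg'[rule_format])
  with bounded_bilinear.FDERIV[OF B f'[rule_format] g'[rule_format]] show ?case
    by (intro Ck_on_SucI[where f' = "\<lambda>x v. B (f x) (g' x v) + B (f' x v) (g x)"]) auto
qed

text \<open>The derivative of \<open>inverse (f x)\<close> is a product containing
  \<open>inverse (f x)\<close> itself, so the induction feeds its own hypothesis for the same
  \<open>f\<close> back into the product rule.\<close>

lemma Ck_on_inverse:
  fixes f :: "'a::real_normed_vector \<Rightarrow> real"
  assumes "Ck_on k S f" and nz: "\<And>x. x \<in> S \<Longrightarrow> f x \<noteq> 0"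
  shows "Ck_on k S (\<lambda>x. inverse (f x))"
  using assms(1)
proof (induction k)
  case 0
  then show ?case
    using nz by (auto intro: continuous_on_inverse)
next
  case (Suc k)
  from Suc.prems obtain f' where f': "\<forall>x\<in>S. (f has_derivative f' x) (at x within S)"
    and Cf': "\<forall>v. Ck_on k S (\<lambda>x. f' x v)"
    by (elim Ck_on_SucE)
  have inv: "Ck_on k S (\<lambda>x. inverse (f x))"
    by (rule Suc.IH[OF Ck_on_Suc_imp_Ck_on[OF Suc.prems]])
  have "Ck_on k S (\<lambda>x. - (inverse (f x) * f' x v * inverse (f x)))" for v
    by (intro Ck_on_bounded_linear[OF bounded_linear_minus[OF bounded_linear_ident]]
        Ck_on_bounded_bilinear[OF bounded_bilinear_mult] inv Cf'[rule_format])
  with Deriv.has_derivative_inverse[OF nz f'[rule_format]] show ?case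
    by (intro Ck_on_SucI[where f' = "\<lambda>x v. - (inverse (f x) * f' x v * inverse (f x))"]) auto
qed

text \<open>For a linear inner map the direction \<open>L v\<close> is independent of the point, so
  the derivative component is again a composition of the same shape and no general higher-order
  chain rule arises.\<close>

lemma Ck_on_compose_bounded_linear:
  assumes L: "bounded_linear L" and "L ` T \<subseteq> S" and "Ck_on k S f"
  shows "Ck_on k T (\<lambda>x. f (L x))"
  using assms(3)
proof (induction k arbitrary: f)
  case 0
  then show ?case
    using assms(2) bounded_linear.continuous_on[OF L continuous_on_id]
    by (auto intro: continuous_on_compose2)
next
  case (Suc k)
  from Suc.prems obtain f' where f': "\<forall>x\<in>S. (f has_derivative f' x) (at x within S)"
    and Cf': "\<forall>v. Ck_on k S (\<lambda>x. f' x v)"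
    by (elim Ck_on_SucE)
  have "((\<lambda>x. f (L x)) has_derivative (\<lambda>v. f' (L x) (L v))) (at x within T)" if "x \<in> T" for x
    by (rule has_derivative_in_compose2[OF _ assms(2) that bounded_linear_imp_has_derivative[OF L]])
      (use f' in blast)
  with Suc.IH[OF Cf'[rule_format]] show ?case
    by (intro Ck_on_SucI[where f' = "\<lambda>x v. f' (L x) (L v)"]) auto
qed

lemma Ck_on_linear: "bounded_linear L \<Longrightarrow> Ck_on k S L"
proof (induction k)
  case 0
  then show ?case
    using bounded_linear.continuous_on[OF _ continuous_on_id] by simp
next
  case (Suc k)
  then show ?case
    by (intro Ck_on_SucI[where f' = "\<lambda>x. L"]) (auto intro: bounded_linear_imp_has_derivative Ck_on_const)
qed

section \<open>Partial derivatives and linear maps\<close>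

lemma dx_linear:
  fixes F :: "real^'d \<Rightarrow> 'a::euclidean_space"
  assumes "linear L" and "(\<lambda>s. F (x + s *\<^sub>R axis j 1)) differentiable (at 0)"
  shows "dx j (\<lambda>y. L (F y)) x = L (dx j F x)"
  unfolding dx_def
  using bounded_linear.has_vector_derivative[OF linear_conv_bounded_linear[THEN iffD1, OF assms(1)]
      vector_derivative_works[THEN iffD1, OF assms(2)]]
  by (rule vector_derivative_at)

lemma dt_linear:
  fixes F :: "'x \<Rightarrow> real \<Rightarrow> 'a::euclidean_space"
  assumes "linear L" and "F x differentiable (at t)"
  shows "dt (\<lambda>x t. L (F x t)) x t = L (dt F x t)"
  unfolding dt_def
  using bounded_linear.has_vector_derivative[OF linear_conv_bounded_linear[THEN iffD1, OF assms(1)]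
      vector_derivative_works[THEN iffD1, OF assms(2)]]
  by (rule vector_derivative_at)

lemma differentiable_along_axis:
  fixes G :: "real^'d \<Rightarrow> 'a::real_normed_vector"
  assumes "G differentiable (at x)"
  shows "(\<lambda>s. G (x + s *\<^sub>R axis j 1)) differentiable (at 0)"
proof -
  have "(\<lambda>s::real. x + s *\<^sub>R axis j (1::real)) differentiable (at 0)"
    by (intro derivative_intros)
  then show ?thesis
    using assms differentiable_chain_at[of "\<lambda>s::real. x + s *\<^sub>R axis j (1::real)" 0 G]
    by (simp add: o_def)
qed

text \<open>\<open>dx\<close> and \<open>dt\<close> are built on \<open>vector_derivative\<close>, a
  choice that says nothing where no derivative exists. Joint differentiability at one point supplies
  existence for every slice used below.\<close>

lemma differentiable_slices:
  fixes F :: "real^'d \<Rightarrow> real \<Rightarrow> 'a::real_normed_vector"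
  assumes "(\<lambda>(x, t). F x t) differentiable (at (x, t))"
  shows "F x differentiable (at t)"
    and "(\<lambda>s. F (x + s *\<^sub>R axis j 1) t) differentiable (at 0)"
proof -
  have "(\<lambda>s. (x, s)) differentiable (at t)"
    by (auto simp: differentiable_def intro!: derivative_eq_intros)
  then show "F x differentiable (at t)"
    using assms differentiable_chain_at[of "\<lambda>s. (x, s)" t "\<lambda>(x, t). F x t"]
    by (simp add: o_def)
  have "(\<lambda>y. (y, t)) differentiable (at x)"
    by (auto simp: differentiable_def intro!: derivative_eq_intros)
  then have "(\<lambda>y. F y t) differentiable (at x)"
    using assms differentiable_chain_at[of "\<lambda>y. (y, t)" x "\<lambda>(x, t). F x t"]
    by (simp add: o_def)
  then show "(\<lambda>s. F (x + s *\<^sub>R axis j 1) t) differentiable (at 0)"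
    by (rule differentiable_along_axis)
qed

section \<open>Partitioned vectors and matrices\<close>

lemma join_nth [simp]: "join u w $ Inl i = u $ i" "join u w $ Inr k = w $ k"
  by (simp_all add: join_def)

lemma block_matrix_nth [simp]:
  "block_matrix M11 M12 M21 M22 $ Inl i $ Inl i' = M11 $ i $ i'"
  "block_matrix M11 M12 M21 M22 $ Inl i $ Inr k' = M12 $ i $ k'"
  "block_matrix M11 M12 M21 M22 $ Inr k $ Inl i' = M21 $ k $ i'"
  "block_matrix M11 M12 M21 M22 $ Inr k $ Inr k' = M22 $ k $ k'"
  by (simp_all add: block_matrix_def)

lemma sum_UNIV_Plus:
  fixes F :: "'a::finite + 'b::finite \<Rightarrow> 'c::comm_monoid_add"
  shows "(\<Sum>a\<in>UNIV. F a) = (\<Sum>i\<in>UNIV. F (Inl i)) + (\<Sum>k\<in>UNIV. F (Inr k))"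
  using sum.Plus[of "UNIV :: 'a set" "UNIV :: 'b set" F] by simp

lemma all_Plus: "(\<forall>a :: 'a + 'b. P a) \<longleftrightarrow> (\<forall>i. P (Inl i)) \<and> (\<forall>k. P (Inr k))"
  by (metis sum.exhaust)

lemma vec_eq_iff_Plus:
  fixes V W :: "'c^('a::finite + 'b::finite)"
  shows "V = W \<longleftrightarrow> (\<forall>i. V $ Inl i = W $ Inl i) \<and> (\<forall>k. V $ Inr k = W $ Inr k)"
  by (simp add: vec_eq_iff all_Plus)

lemma matrix_eq_iff_Plus:
  fixes M N :: "'c^('a::finite + 'b::finite)^('a + 'b)"
  shows "M = N \<longleftrightarrow>
    (\<forall>i i'. M $ Inl i $ Inl i' = N $ Inl i $ Inl i') \<and> (\<forall>i k. M $ Inl i $ Inr k = N $ Inl i $ Inr k) \<and>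
    (\<forall>k i. M $ Inr k $ Inl i = N $ Inr k $ Inl i) \<and> (\<forall>k k'. M $ Inr k $ Inr k' = N $ Inr k $ Inr k')"
  by (auto simp: vec_eq_iff_Plus)

section \<open>The D2Q5 velocities and weights\<close>

lemma dir_simps [simp]: "dir 1 = 2" "dir 2 = 3" "dir 3 = 4" "dir 4 = 5"
  by (simp_all add: dir_def)

lemma exhaust_5: "i = 1 \<or> i = 2 \<or> i = 3 \<or> i = 4 \<or> i = 5" for i :: 5
proof (induct i)
  case (of_int z)
  \<comment> \<open>The type \<open>5\<close> consists of residues modulo 5, and the representative
    0 is the element \<open>5\<close>.\<close>
  then have "z = 0 \<or> z = 1 \<or> z = 2 \<or> z = 3 \<or> z = 4"
    by fastforce
  then show ?case
    by auto
qed

lemma dir_neq_1 [simp]: "dir k \<noteq> 1"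
  by (simp add: dir_def)

lemma inj_dir: "inj dir"
  by (auto simp: inj_def forall_4)

lemma UNIV_5_dir: "(UNIV :: 5 set) = insert 1 (range dir)"
proof -
  have "i \<in> insert 1 (range dir)" for i
    using exhaust_5[of i] by (metis dir_simps insertCI rangeI)
  then show ?thesis
    by auto
qed

lemma sum_UNIV_5: "(\<Sum>i\<in>(UNIV :: 5 set). F i) = F 1 + (\<Sum>k\<in>UNIV. F (dir k))"
proof -
  have "(1::5) \<notin> range dir"
    by (metis dir_neq_1 imageE)
  then show ?thesis
    by (simp add: UNIV_5_dir sum.reindex[OF inj_dir])
qed

lemma all_5: "(\<forall>i::5. P i) \<longleftrightarrow> P 1 \<and> (\<forall>k. P (dir k))"
  by (metis UNIV_5_dir UNIV_I imageE insertE)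

lemma omega_simps [simp]: "omega 1 = 1/3" "omega (dir k) = 1/6"
  by (simp_all add: omega_def)

lemma xi_1 [simp]: "xi 1 = 0"
  by (simp add: xi_def)

text \<open>Opposite velocities cancel. This is why neither the drift part of the equilibrium nor
  the shift from populations to \<open>h\<close> contributes to the mass balance.\<close>

lemma sum_xi_dir: "(\<Sum>k\<in>UNIV. xi (dir k) $ j) = 0"
  using exhaust_2[of j] by (auto simp: sum_4 xi_def)

lemma sum_xi_xi_dir: "(\<Sum>k\<in>UNIV. xi (dir k) $ i * xi (dir k) $ j) = (if i = j then 2 else 0)"
  using exhaust_2[of i] exhaust_2[of j] by (auto simp: sum_4 xi_def)

section \<open>Equivalence of the three forms of the model\<close>

lemma lb_vars_nth:
  "lb_vars g $ Inl i = (\<Sum>i\<in>UNIV. g $ i)"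
  "lb_vars g $ Inr k = g $ dir k - 1/6 * (\<Sum>i\<in>UNIV. g $ i)"
  by (simp_all add: lb_vars_def Let_def)

lemma linear_lb_vars: "linear lb_vars"
  by (rule linearI)
    (simp_all add: vec_eq_iff_Plus lb_vars_nth sum.distrib algebra_simps flip: sum_distrib_left)

lemma bij_lb_vars: "bij lb_vars"
proof (rule bijI)
  show "inj lb_vars"
  proof (rule injI)
    fix g g' assume eq: "lb_vars g = lb_vars g'"
    then have sum: "(\<Sum>i\<in>UNIV. g $ i) = (\<Sum>i\<in>UNIV. g' $ i)"
      by (metis lb_vars_nth(1))
    with eq have dir: "g $ dir k = g' $ dir k" for k
      by (metis lb_vars_nth(2) add_right_cancel diff_add_cancel)
    with sum have "g $ 1 = g' $ 1"
      by (simp add: sum_UNIV_5)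
    with dir show "g = g'"
      by (simp add: vec_eq_iff all_5)
  qed
  show "surj lb_vars"
  proof (unfold surj_def, rule allI)
    fix V :: "real^(1 + 4)"
    \<comment> \<open>These are the moving populations recovered from the deviations, with 1/6 their
      weight; the rest population is then forced by the total mass.\<close>
    define h where "h k = V $ Inr k + 1/6 * V $ Inl 1" for k
    define g :: "real^5" where
      "g = (\<chi> i. if i = 1 then V $ Inl 1 - (\<Sum>k\<in>UNIV. h k) else h (inv dir i))"
    have g: "g $ 1 = V $ Inl 1 - (\<Sum>k\<in>UNIV. h k)" "g $ dir k = h k" for k
      by (simp_all add: g_def inv_f_f[OF inj_dir])
    then have "lb_vars g = V"
      by (simp add: vec_eq_iff_Plus lb_vars_nth sum_UNIV_5 h_def)
    then show "\<exists>g. V = lb_vars g"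
      by metis
  qed
qed

text \<open>Velocities and weights are constant, so every flux component is a fixed linear
  functional of \<open>U\<close> and the divergences become linear combinations of the vectors
  \<open>B j\<close>. Comparing the forms of the model is then pure algebra.\<close>

lemma lb_uh_equations_iff:
  fixes U :: "real^2 \<Rightarrow> real \<Rightarrow> real^(1 + 4)" and x :: "real^2"
  assumes U: "(\<lambda>(x, t). U x t) differentiable (at (x, t))"
  defines "B \<equiv> \<lambda>j. dx j (\<lambda>y. U y t) x"
  shows "lb_uh_equations \<tau> f \<epsilon> U x t \<longleftrightarrow>
    dt U x t $ Inl 1 + 1 / \<epsilon> * (\<Sum>j\<in>UNIV. \<Sum>l\<in>UNIV. xi (dir l) $ j * B j $ Inr l) = 0 \<and>
    (\<forall>k. dt U x t $ Inr k
       + 1 / \<epsilon> * (\<Sum>j\<in>UNIV. xi (dir k) $ j * B j $ Inr k + 1/6 * (xi (dir k) $ j * B j $ Inl 1)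
                     - 1/6 * (\<Sum>l\<in>UNIV. xi (dir l) $ j * B j $ Inr l))
       = 1 / \<epsilon>\<^sup>2 * (1 / \<tau> (U x t $ Inl 1)) *
           (3 * \<epsilon> * (1/6) * (xi (dir k) \<bullet> f (U x t $ Inl 1)) - U x t $ Inr k))"
proof -
  note diff = differentiable_slices[OF U]
  have dt: "dt (\<lambda>x t. U x t $ c) x t = dt U x t $ c" for c
    by (rule dt_linear[where F = U, OF _ diff(1)]) (rule bounded_linear.linear[OF bounded_linear_vec_nth])
  have "dx j (\<lambda>y. (\<Sum>l\<in>UNIV. U y t $ Inr l *\<^sub>R xi (dir l)) $ j) x
      = (\<Sum>l\<in>UNIV. B j $ Inr l *\<^sub>R xi (dir l)) $ j" for j
    unfolding B_def
    by (rule dx_linear[OF _ diff(2), where L = "\<lambda>V. (\<Sum>l\<in>UNIV. V $ Inr l *\<^sub>R xi (dir l)) $ j"])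
      (auto intro!: linearI simp: algebra_simps sum.distrib sum_distrib_left)
  then have div_m: "div_op (\<lambda>y. \<Sum>l\<in>UNIV. U y t $ Inr l *\<^sub>R xi (dir l)) x
      = (\<Sum>j\<in>UNIV. \<Sum>l\<in>UNIV. xi (dir l) $ j * B j $ Inr l)"
    by (simp add: div_op_def mult.commute)
  have "dx j (\<lambda>y. (U y t $ Inr k *\<^sub>R xi (dir k) + (1/6 * U y t $ Inl 1) *\<^sub>R xi (dir k)
        - (1/6) *\<^sub>R (\<Sum>l\<in>UNIV. U y t $ Inr l *\<^sub>R xi (dir l))) $ j) x
      = (B j $ Inr k *\<^sub>R xi (dir k) + (1/6 * B j $ Inl 1) *\<^sub>R xi (dir k)
        - (1/6) *\<^sub>R (\<Sum>l\<in>UNIV. B j $ Inr l *\<^sub>R xi (dir l))) $ j" for j k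
    unfolding B_def
    by (rule dx_linear[OF _ diff(2), where L = "\<lambda>V. (V $ Inr k *\<^sub>R xi (dir k)
        + (1/6 * V $ Inl 1) *\<^sub>R xi (dir k) - (1/6) *\<^sub>R (\<Sum>l\<in>UNIV. V $ Inr l *\<^sub>R xi (dir l))) $ j"])
      (auto intro!: linearI simp: algebra_simps sum.distrib sum_distrib_left add_divide_distrib)
  then have div_h: "div_op (\<lambda>y. U y t $ Inr k *\<^sub>R xi (dir k) + (1/6 * U y t $ Inl 1) *\<^sub>R xi (dir k)
        - (1/6) *\<^sub>R (\<Sum>l\<in>UNIV. U y t $ Inr l *\<^sub>R xi (dir l))) x
      = (\<Sum>j\<in>UNIV. xi (dir k) $ j * B j $ Inr k + 1/6 * (xi (dir k) $ j * B j $ Inl 1)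
          - 1/6 * (\<Sum>l\<in>UNIV. xi (dir l) $ j * B j $ Inr l))" for k
    by (simp add: div_op_def mult.commute)
  show ?thesis
    unfolding lb_uh_equations_def Let_def omega_simps dt div_m div_h ..
qed

lemma lb_A_mult_nth:
  "(lb_A j U \<epsilon> *v V) $ Inl i = (\<Sum>l\<in>UNIV. xi (dir l) $ j * V $ Inr l)"
  "(lb_A j U \<epsilon> *v V) $ Inr k = xi (dir k) $ j * V $ Inr k + 1/6 * (xi (dir k) $ j * V $ Inl 1)
     - 1/6 * (\<Sum>l\<in>UNIV. xi (dir l) $ j * V $ Inr l)"
  by (simp_all add: lb_A_def matrix_vector_mult_def sum_UNIV_Plus left_diff_distrib sum_subtractf
      sum_distrib_left if_distrib[of "\<lambda>z. z * _"] cong: if_cong)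

lemma lb_Q_nth:
  "lb_Q \<tau> f U \<epsilon> $ Inl i = 0"
  "lb_Q \<tau> f U \<epsilon> $ Inr k
     = 1 / \<tau> (U $ Inl 1) * (3 * \<epsilon> * (1/6) * (xi (dir k) \<bullet> f (U $ Inl 1)) - U $ Inr k)"
  by (simp_all add: lb_Q_def Let_def)

lemma lb_uh_equations_iff_relaxation_system:
  assumes "(\<lambda>(x, t). U x t) differentiable (at (x, t))"
  shows "lb_uh_equations \<tau> f \<epsilon> U x t \<longleftrightarrow> relaxation_system lb_A (lb_Q \<tau> f) \<epsilon> U x t"
  unfolding lb_uh_equations_iff[OF assms] relaxation_system_def vec_eq_iff_Plus
  by (simp add: lb_A_mult_nth lb_Q_nth)

text \<open>\<open>R i\<close> is the residual of the \<open>i\<close>-th kinetic equation. The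
  change of variables acts on residuals as on populations: the \<open>u\<close> equation has
  residual \<open>R0\<close>, the sum of all \<open>R i\<close>, and the \<open>h\<close> equation
  in direction \<open>dir k\<close> has residual \<open>R (dir k) - 1/6 * R0\<close>. Both families
  vanish together.\<close>

lemma lb_equation_iff_lb_uh_equations:
  assumes g: "(\<lambda>(x, t). g x t) differentiable (at (x, t))"
  shows "lb_equation \<tau> f \<epsilon> g x t \<longleftrightarrow> lb_uh_equations \<tau> f \<epsilon> (\<lambda>x t. lb_vars (g x t)) x t"
proof -
  note diff = differentiable_slices[OF g]
  define a where "a = dt g x t"
  define B where "B j = dx j (\<lambda>y. g y t) x" for j
  define u where "u = (\<Sum>i\<in>UNIV. g x t $ i)"
  define s where "s = 1 / \<epsilon>\<^sup>2 * (1 / \<tau> u)"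
  define R where "R i = a $ i + 1 / \<epsilon> * (\<Sum>j\<in>UNIV. xi i $ j * B j $ i)
    - s * (omega i * u + 3 * \<epsilon> * omega i * (xi i \<bullet> f u) - g x t $ i)" for i
  define R0 where "R0 = (\<Sum>i\<in>UNIV. R i)"

  have "dt (\<lambda>x t. g x t $ i) x t = a $ i" for i
    unfolding a_def by (rule dt_linear[where F = g, OF _ diff(1)]) (rule bounded_linear.linear[OF bounded_linear_vec_nth])
  moreover have "dx j (\<lambda>y. g y t $ i) x = B j $ i" for i j
    unfolding B_def by (rule dx_linear[OF _ diff(2)]) (rule bounded_linear.linear[OF bounded_linear_vec_nth])
  ultimately have lb: "lb_equation \<tau> f \<epsilon> g x t \<longleftrightarrow> (\<forall>i. R i = 0)"
    unfolding lb_equation_def Let_def u_def[symmetric] s_def[symmetric] R_def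
    by (simp add: grad_def inner_vec_def[of "xi _" "vec_lambda _"])

  have lbdiff: "(\<lambda>(x, t). lb_vars (g x t)) differentiable (at (x, t))"
    using differentiable_compose[OF linear_imp_differentiable[OF linear_lb_vars] g]
    by (simp add: case_prod_beta')
  have dt: "dt (\<lambda>x t. lb_vars (g x t)) x t = lb_vars a"
    unfolding a_def by (rule dt_linear[where F = g, OF linear_lb_vars diff(1)])
  have dx: "dx j (\<lambda>y. lb_vars (g y t)) x = lb_vars (B j)" for j
    unfolding B_def by (rule dx_linear[OF linear_lb_vars diff(2)])
  have flux: "(\<Sum>l\<in>UNIV. xi (dir l) $ j * lb_vars V $ Inr l) = (\<Sum>l\<in>UNIV. xi (dir l) $ j * V $ dir l)"
    for V j
  proof -
    have "(\<Sum>l\<in>UNIV. xi (dir l) $ j * lb_vars V $ Inr l)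
        = (\<Sum>l\<in>UNIV. xi (dir l) $ j * V $ dir l)
          - (\<Sum>l\<in>UNIV. xi (dir l) $ j) * (1/6 * (\<Sum>i\<in>UNIV. V $ i))"
      unfolding lb_vars_nth right_diff_distrib sum_subtractf sum_distrib_right ..
    then show ?thesis
      by (simp add: sum_xi_dir)
  qed

  have "(\<Sum>k\<in>UNIV. xi (dir k)) = 0"
    by (simp add: vec_eq_iff sum_xi_dir)
  then have "(\<Sum>k\<in>UNIV. xi (dir k) \<bullet> f u) = 0"
    by (simp flip: inner_sum_left)
  moreover have "(\<Sum>k\<in>UNIV. s * (1/6 * u + 3 * \<epsilon> * (1/6) * (xi (dir k) \<bullet> f u) - g x t $ dir k))
      = s * (4/6 * u + 3 * \<epsilon> * (1/6) * (\<Sum>k\<in>UNIV. xi (dir k) \<bullet> f u) - (\<Sum>k\<in>UNIV. g x t $ dir k))"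
    by (simp add: sum_subtractf sum.distrib flip: sum_distrib_left sum_divide_distrib)
  \<comment> \<open>Collisions conserve mass: the weights add up to 1/3 + 4/6 = 1 and the drift
    terms cancel.\<close>
  ultimately have src: "s * (1/3 * u - g x t $ 1)
      + (\<Sum>k\<in>UNIV. s * (1/6 * u + 3 * \<epsilon> * (1/6) * (xi (dir k) \<bullet> f u) - g x t $ dir k)) = 0"
    by (simp add: u_def sum_UNIV_5 algebra_simps)
  have "R0 = (\<Sum>i\<in>UNIV. a $ i)
      + 1 / \<epsilon> * (\<Sum>l\<in>UNIV. \<Sum>j\<in>UNIV. xi (dir l) $ j * B j $ dir l)"
    using src unfolding R0_def R_def sum_UNIV_5 omega_simps xi_1 sum_subtractf sum.distrib
    by (simp add: sum_distrib_left)
  also have "(\<Sum>l\<in>UNIV. \<Sum>j\<in>UNIV. xi (dir l) $ j * B j $ dir l)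
      = (\<Sum>j\<in>UNIV. \<Sum>l\<in>UNIV. xi (dir l) $ j * B j $ dir l)"
    by (rule sum.swap)
  finally have R0: "R0 = (\<Sum>i\<in>UNIV. a $ i)
      + 1 / \<epsilon> * (\<Sum>j\<in>UNIV. \<Sum>l\<in>UNIV. xi (dir l) $ j * B j $ dir l)" .

  \<comment> \<open>The transport of \<open>h\<close> plus that of u/6 is the transport of the
    population itself; the subtracted total flux belongs to \<open>1/6 * R0\<close>.\<close>
  have h: "lb_vars a $ Inr k
      + 1 / \<epsilon> * (\<Sum>j\<in>UNIV. xi (dir k) $ j * lb_vars (B j) $ Inr k
                     + 1/6 * (xi (dir k) $ j * lb_vars (B j) $ Inl 1)
                    - 1/6 * (\<Sum>l\<in>UNIV. xi (dir l) $ j * B j $ dir l))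
      - s * (3 * \<epsilon> * (1/6) * (xi (dir k) \<bullet> f u) - lb_vars (g x t) $ Inr k)
      = R (dir k) - 1/6 * R0" for k
  proof -
    have "(\<Sum>j\<in>UNIV. xi (dir k) $ j * lb_vars (B j) $ Inr k
                     + 1/6 * (xi (dir k) $ j * lb_vars (B j) $ Inl 1)
                    - 1/6 * (\<Sum>l\<in>UNIV. xi (dir l) $ j * B j $ dir l))
      = (\<Sum>j\<in>UNIV. xi (dir k) $ j * B j $ dir k)
        - 1/6 * (\<Sum>j\<in>UNIV. \<Sum>l\<in>UNIV. xi (dir l) $ j * B j $ dir l)"
      by (simp add: lb_vars_nth algebra_simps sum_subtractf sum.distrib
          flip: sum_distrib_left sum_divide_distrib)
    then show ?thesis
      unfolding R0 by (simp only: R_def) (simp add: lb_vars_nth u_def algebra_simps)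
  qed
  have "lb_uh_equations \<tau> f \<epsilon> (\<lambda>x t. lb_vars (g x t)) x t \<longleftrightarrow>
      R0 = 0 \<and> (\<forall>k. R (dir k) - 1/6 * R0 = 0)"
    unfolding lb_uh_equations_iff[OF lbdiff] dt dx flux
    unfolding h[symmetric] unfolding R0
    by (simp only: lb_vars_nth(1) u_def[symmetric] s_def[symmetric] right_minus_eq)
  also have "\<dots> \<longleftrightarrow> (\<forall>i. R i = 0)"
    \<comment> \<open>The rest population has no equation of its own in the new variables;
      \<open>R 1\<close> is \<open>R0\<close> minus the other residuals.\<close>
    by (auto simp: all_5 R0_def sum_UNIV_5)
  finally show ?thesis
    using lb by blast
qed

section \<open>Convergence criteria\<close>

lemma bounded_linear_join: "bounded_linear (join 0 :: real^'r::finite \<Rightarrow> real^('m::finite + 'r))"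
  by (rule linear_conv_bounded_linear[THEN iffD1]) (auto intro!: linearI simp: vec_eq_iff_Plus)

lemma bounded_linear_w_part: "bounded_linear (w_part :: real^('m::finite + 'r::finite) \<Rightarrow> real^'r)"
  by (rule linear_conv_bounded_linear[THEN iffD1]) (auto intro!: linearI simp: vec_eq_iff w_part_def)

lemma w_part_join [simp]: "w_part (join u w) = w"
  by (simp add: w_part_def vec_eq_iff)

lemma transpose_zero [simp]: "transpose 0 = 0"
  by (simp add: transpose_def vec_eq_iff)

lemma block_matrix_mult:
  "block_matrix A B C D ** block_matrix A' B' C' D'
     = block_matrix (A ** A' + B ** C') (A ** B' + B ** D') (C ** A' + D ** C') (C ** B' + D ** D')"
  by (simp add: matrix_eq_iff_Plus matrix_matrix_mult_def sum_UNIV_Plus)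

lemma transpose_block_matrix:
  "transpose (block_matrix A B C D)
     = block_matrix (transpose A) (transpose C) (transpose B) (transpose D)"
  by (simp add: matrix_eq_iff_Plus transpose_def)

lemma u_part_join [simp]: "u_part (join u w) = u"
  by (simp add: u_part_def vec_eq_iff)

lemma block_matrix_add:
  "block_matrix A B C D + block_matrix A' B' C' D'
     = block_matrix (A + A') (B + B') (C + C') (D + D')"
  by (simp add: matrix_eq_iff_Plus)

lemma uminus_block_matrix: "- block_matrix A B C D = block_matrix (- A) (- B) (- C) (- D)"
  by (simp add: matrix_eq_iff_Plus)

lemma matrix_mult_mat: "(A :: real^'n^'m) ** mat c = c *\<^sub>R A"
  by (simp add: vec_eq_iff matrix_matrix_mult_def mat_def if_distrib cong: if_cong)

lemma mat_mult_matrix: "mat c ** (A :: real^'n^'m) = c *\<^sub>R A"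
  by (simp add: vec_eq_iff matrix_matrix_mult_def mat_def if_distrib[of "\<lambda>z. z * _"] cong: if_cong)

lemma matrix_mult_zero [simp]: "(A :: real^'n^'m) ** 0 = 0" "0 ** (B :: real^'n^'m) = 0"
  by (simp_all add: vec_eq_iff matrix_matrix_mult_def)

lemma matrix_inv_mat:
  assumes "c \<noteq> 0"
  shows "invertible (mat c :: real^'n^'n)" and "matrix_inv (mat c :: real^'n^'n) = mat (1 / c)"
proof -
  have inv: "mat c ** mat (1 / c) = (mat 1 :: real^'n^'n)" "mat (1 / c) ** mat c = (mat 1 :: real^'n^'n)"
    using assms unfolding mat_mult_matrix by (simp_all add: vec_eq_iff mat_def)
  then show "invertible (mat c :: real^'n^'n)"
    unfolding invertible_def by blast
  then have "matrix_inv (mat c) ** (mat c :: real^'n^'n) = mat 1"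
    unfolding matrix_inv_def invertible_def by (rule someI2_ex) blast
  then show "matrix_inv (mat c :: real^'n^'n) = mat (1 / c)"
    by (metis inv(1) matrix_mul_assoc matrix_mul_lid matrix_mul_rid)
qed

lemma sym_pos_def_block_diag:
  assumes M: "sym_pos_def M" and N: "sym_pos_def N"
  shows "sym_pos_def (block_matrix M 0 0 N)"
proof -
  have form: "V \<bullet> (block_matrix M 0 0 N *v V)
      = u_part V \<bullet> (M *v u_part V) + w_part V \<bullet> (N *v w_part V)" for V
    by (simp add: inner_vec_def matrix_vector_mult_def sum_UNIV_Plus u_part_def w_part_def)
  have nonneg: "0 \<le> u \<bullet> (M *v u)" "0 \<le> w \<bullet> (N *v w)" for u w
    using M N unfolding sym_pos_def_def by (metis inner_zero_left less_eq_real_def)+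
  have "0 < V \<bullet> (block_matrix M 0 0 N *v V)" if "V \<noteq> 0" for V
  proof -
    have "u_part V \<noteq> 0 \<or> w_part V \<noteq> 0"
      using that by (auto simp: vec_eq_iff_Plus u_part_def w_part_def vec_eq_iff)
    then show ?thesis
      using M N nonneg unfolding form sym_pos_def_def
      by (metis add_nonneg_pos add_pos_nonneg)
  qed
  then show ?thesis
    using M N by (simp add: sym_pos_def_def transpose_block_matrix)
qed

lemma sym_pos_def_scaleR:
  assumes "0 < c" and "sym_pos_def M"
  shows "sym_pos_def (c *\<^sub>R M)"
proof -
  have "transpose (c *\<^sub>R M) = c *\<^sub>R transpose M"
    by (simp add: transpose_def vec_eq_iff)
  then show ?thesis
    using assms by (simp add: sym_pos_def_def scaleR_matrix_vector_assoc[symmetric])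
qed

lemma sym_pos_def_mat_1: "sym_pos_def (mat 1)"
  by (simp add: sym_pos_def_def)

text \<open>
  The energy \<open>\<Sum>\<^sub>i g\<^sub>i\<^sup>2 / \<omega>\<^sub>i\<close> symmetrizes the diagonal system for the \<open>g\<^sub>i\<close>. With
  \<open>h\<^sub>1 = - \<Sum>\<^sub>k h\<^sub>k\<close> it becomes \<open>u\<^sup>2 + 6 \<Sum>\<^sub>k h\<^sub>k\<^sup>2 + 3 (\<Sum>\<^sub>k h\<^sub>k)\<^sup>2\<close>, whose matrix is
  \<open>block_matrix (mat 1) 0 0 lb_gram\<close>.
\<close>

definition lb_gram :: "real^4^4" where
  "lb_gram = (\<chi> k l. (if k = l then 6 else 0) + 3)"

lemma sym_pos_def_lb_gram: "sym_pos_def lb_gram"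
proof -
  have "v \<bullet> (lb_gram *v v) = 6 * (v \<bullet> v) + 3 * (\<Sum>k\<in>UNIV. v $ k)\<^sup>2" for v
    by (simp add: lb_gram_def inner_vec_def matrix_vector_mult_def sum_4 power2_eq_square algebra_simps)
  then have "0 < v \<bullet> (lb_gram *v v)" if "v \<noteq> 0" for v
    using that by (simp add: add_pos_nonneg)
  moreover have "transpose lb_gram = lb_gram"
    by (simp add: transpose_def lb_gram_def vec_eq_iff)
  ultimately show ?thesis
    by (simp add: sym_pos_def_def)
qed

lemma lb_gram_nth_sum:
  "(\<Sum>l\<in>UNIV. lb_gram $ k $ l * c l) = 6 * c k + 3 * (\<Sum>l\<in>UNIV. c l)"
  by (simp add: lb_gram_def distrib_right sum.distrib if_distrib[of "\<lambda>z. z * _"] cong: if_cong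
      flip: sum_distrib_left)

text \<open>The 22 block of \<open>lb_A\<close> has entries \<delta>_kl xi_k - xi_l/6. The part 6 Id
  of \<open>lb_gram\<close> turns the second term into -xi_l, and the all-threes part adds 3 (1 -
  4/6) xi_l = xi_l, so only a diagonal remains. In the 21 block the all-threes part vanishes because
  the velocities sum to zero.\<close>

lemma lb_symmetrizer_mult:
  "block_matrix (mat 1) 0 0 lb_gram ** lb_A j U \<epsilon>
     = block_matrix 0 (\<chi> i k. xi (dir k) $ j) (\<chi> k i. xi (dir k) $ j)
         (\<chi> k l. if k = l then 6 * xi (dir k) $ j else 0)"
proof -
  have 21: "lb_gram ** (\<chi> k i. omega (dir k) * xi (dir k) $ j) = (\<chi> k i. xi (dir k) $ j)"
    by (simp add: vec_eq_iff matrix_matrix_mult_def lb_gram_nth_sum sum_xi_dir flip: sum_divide_distrib)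
  have 22: "lb_gram ** (\<chi> k l. (if k = l then xi (dir k) $ j else 0) - omega (dir k) * xi (dir l) $ j)
      = (\<chi> k l. if k = l then 6 * xi (dir k) $ j else 0)"
    by (simp add: vec_eq_iff matrix_matrix_mult_def lb_gram_nth_sum sum_subtractf)
  show ?thesis
    unfolding lb_A_def block_matrix_mult 21 22 by simp
qed

lemma criterion_iii_lb: "criterion_iii \<Omega> lb_A (\<lambda>U \<epsilon>. block_matrix (mat 1) 0 0 lb_gram)"
proof -
  let ?A0 = "block_matrix (mat 1) 0 0 lb_gram :: real^(1 + 4)^(1 + 4)"
  have pd: "sym_pos_def ?A0"
    by (intro sym_pos_def_block_diag sym_pos_def_mat_1 sym_pos_def_lb_gram)
  \<comment> \<open>For symmetric \<open>?A0\<close>, the required identity says exactly that the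
    product is a symmetric matrix.\<close>
  have "?A0 ** lb_A j U \<epsilon> = transpose (?A0 ** lb_A j U \<epsilon>)" for j U \<epsilon>
    unfolding lb_symmetrizer_mult by (auto simp: matrix_eq_iff_Plus transpose_def)
  then have "?A0 ** lb_A j U \<epsilon> = transpose (lb_A j U \<epsilon>) ** ?A0" for j U \<epsilon>
    using pd by (metis matrix_transpose_mul sym_pos_def_def)
  with pd show ?thesis
    by (simp add: criterion_iii_def)
qed

section \<open>Linearization and dissipation of the source\<close>

lemma lb_Q_eps_0: "lb_Q \<tau> f U 0 = (1 / \<tau> (U $ Inl 1)) *\<^sub>R join 0 (- w_part U)"
  by (simp add: vec_eq_iff_Plus lb_Q_def w_part_def)

text \<open>The product rule also differentiates the rate 1/\<tau>, but that term is multiplied by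
  \<open>?L (join u 0)\<close>, which is zero. So the derivative \<open>c'\<close> may stay
  unspecified.\<close>

lemma dU_Q_lb_Q:
  assumes "\<tau> differentiable (at (u $ 1))" and "\<tau> (u $ 1) \<noteq> 0"
  shows "dU_Q (lb_Q \<tau> f) u = block_matrix 0 0 0 (mat (- (1 / \<tau> (u $ 1))))"
proof -
  let ?L = "\<lambda>U :: real^(1 + 4). join 0 (- w_part U) :: real^(1 + 4)"
  have L: "bounded_linear ?L"
    by (intro bounded_linear_compose[OF bounded_linear_join] bounded_linear_minus bounded_linear_w_part)
  have "(\<lambda>U :: real^(1 + 4). U $ Inl 1) differentiable (at (join u 0))"
    by (simp add: bounded_linear_imp_differentiable bounded_linear_vec_nth)
  then have "(\<lambda>U :: real^(1 + 4). \<tau> (U $ Inl 1)) differentiable (at (join u 0))"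
    using assms(1) differentiable_chain_at[of "\<lambda>U :: real^(1 + 4). U $ Inl 1" "join u 0" \<tau>]
    by (simp add: o_def)
  then have "(\<lambda>U :: real^(1 + 4). 1 / \<tau> (U $ Inl 1)) differentiable (at (join u 0))"
    using assms(2) by (intro derivative_intros) auto
  then obtain c' where
    "((\<lambda>U :: real^(1 + 4). 1 / \<tau> (U $ Inl 1)) has_derivative c') (at (join u 0))"
    by (auto simp: differentiable_def)
  from has_derivative_scaleR[OF this bounded_linear_imp_has_derivative[OF L]]
  have "((\<lambda>U. lb_Q \<tau> f U 0) has_derivative (\<lambda>V. (1 / \<tau> (u $ 1)) *\<^sub>R ?L V)) (at (join u 0))"
    by (simp add: lb_Q_eps_0 bounded_linear.linear[OF bounded_linear_join, THEN linear_0])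
  note frechet_derivative_at[OF this, symmetric]
  then show ?thesis
    by (simp add: dU_Q_def matrix_eq_iff_Plus matrix_def mat_def axis_def w_part_def)
qed

lemma dw_q_lb_Q: "dw_q (lb_Q \<tau> f) u = mat (- (1 / \<tau> (u $ 1)))"
proof -
  have "(\<lambda>w. q_of (lb_Q \<tau> f) (join u w) 0) = (\<lambda>w. (- (1 / \<tau> (u $ 1))) *\<^sub>R w)"
    by (simp add: fun_eq_iff vec_eq_iff q_of_def lb_Q_def)
  moreover have "((\<lambda>w :: real^4. (- (1 / \<tau> (u $ 1))) *\<^sub>R w) has_derivative
      (\<lambda>w. (- (1 / \<tau> (u $ 1))) *\<^sub>R w)) (at 0)"
    by (intro bounded_linear_imp_has_derivative bounded_linear_scaleR_right)
  ultimately have "frechet_derivative (\<lambda>w. q_of (lb_Q \<tau> f) (join u w) 0) (at 0)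
      = (\<lambda>w. (- (1 / \<tau> (u $ 1))) *\<^sub>R w)"
    by (metis frechet_derivative_at)
  then show ?thesis
    by (simp add: dw_q_def vec_eq_iff matrix_def mat_def axis_def)
qed

text \<open>The linearized source is -1/\<tau> times the identity on the \<open>w\<close> block and
  commutes with the block diagonal symmetrizer. The inequality is in fact an equality, which
  dictates the witness \<open>S u\<close> = (2/\<tau>) \<open>lb_gram\<close>.\<close>

lemma criterion_iv_lb:
  assumes "\<And>u. u \<in> \<Omega>u \<Longrightarrow> \<tau> differentiable (at (u $ 1))" and pos: "\<And>u. u \<in> \<Omega>u \<Longrightarrow> 0 < \<tau> (u $ 1)"
  shows "criterion_iv \<Omega>u (lb_Q \<tau> f) (\<lambda>U \<epsilon>. block_matrix (mat 1) 0 0 lb_gram)"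
proof -
  have "block_matrix (mat 1) 0 0 lb_gram ** dU_Q (lb_Q \<tau> f) u
      + transpose (dU_Q (lb_Q \<tau> f) u) ** block_matrix (mat 1) 0 0 lb_gram
      = - block_matrix 0 0 0 ((2 / \<tau> (u $ 1)) *\<^sub>R lb_gram)" if "u \<in> \<Omega>u" for u
  proof -
    have "transpose (mat c :: real^4^4) = mat c" for c
      by (auto simp: vec_eq_iff transpose_def mat_def)
    then show ?thesis
      using assms(1)[OF that] pos[OF that]
      by (simp add: dU_Q_lb_Q transpose_block_matrix block_matrix_mult block_matrix_add
          uminus_block_matrix matrix_mult_mat mat_mult_matrix)
        (simp add: matrix_eq_iff_Plus)
  qed
  moreover have "sym_pos_def ((2 / \<tau> (u $ 1)) *\<^sub>R lb_gram)" if "u \<in> \<Omega>u" for u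
    using pos[OF that] by (intro sym_pos_def_scaleR sym_pos_def_lb_gram) simp
  ultimately show ?thesis
    unfolding criterion_iv_def quadratic_form_le_def
    by (intro exI[of _ "\<lambda>u. (2 / \<tau> (u $ 1)) *\<^sub>R lb_gram"]) simp
qed

lemma blk11_lb_A [simp]: "blk11 (lb_A j U \<epsilon>) = 0"
  by (simp add: lb_A_def blk11_def vec_eq_iff)

lemma criterion_v_lb: "criterion_v \<Omega>u lb_A"
  by (simp add: criterion_v_def)

lemma smooth_on_lb_Q:
  fixes f :: "real \<Rightarrow> real^2"
  assumes f: "smooth_on I f" and D: "smooth_on I D" and pos: "\<forall>u\<in>I. 0 < D u"
    and \<Omega>: "\<And>U. U \<in> \<Omega> \<Longrightarrow> U $ Inl 1 \<in> I"
  shows "smooth_on (\<Omega> \<times> T) (\<lambda>(U, \<epsilon>). lb_Q (\<lambda>u. 3 * D u) f U \<epsilon>)"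
  unfolding smooth_on_def
proof
  fix k
  let ?S = "\<Omega> \<times> T :: ((real^(1 + 4)) \<times> real) set"
  let ?u = "\<lambda>p :: (real^(1 + 4)) \<times> real. fst p $ Inl 1"
  have u: "bounded_linear ?u"
    by (intro bounded_linear_compose[OF bounded_linear_vec_nth] bounded_linear_fst)
  have uS: "?u ` ?S \<subseteq> I"
    using \<Omega> by auto
  have "Ck_on k I D" "Ck_on k I f"
    using f D by (simp_all add: smooth_on_def)
  note Df = this[THEN Ck_on_compose_bounded_linear[OF u uS]]
  have rate: "Ck_on k ?S (\<lambda>p. 1 / (3 * D (?u p)))"
    unfolding inverse_eq_divide[symmetric]
  proof (rule Ck_on_inverse)
    show "Ck_on k ?S (\<lambda>p. 3 * D (?u p))"
      by (rule Ck_on_bounded_linear[OF bounded_linear_mult_right Df(1)])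
    show "3 * D (?u p) \<noteq> 0" if "p \<in> ?S" for p
      using pos uS that by force
  qed
  \<comment> \<open>Factorization into the nonlinear rate and an expression built from bounded
    linear maps and one scalar multiplication; 1/2 is 3 times the weight 1/6.\<close>
  have eq: "(\<lambda>(U, \<epsilon>). lb_Q (\<lambda>u. 3 * D u) f U \<epsilon>) = (\<lambda>p. (1 / (3 * D (?u p))) *\<^sub>R
      join 0 (snd p *\<^sub>R (\<chi> l. 1/2 * (xi (dir l) \<bullet> f (?u p))) + (- w_part (fst p))))"
    by (simp add: fun_eq_iff vec_eq_iff_Plus lb_Q_def Let_def w_part_def)
  have xi_lin: "bounded_linear (\<lambda>v :: real^2. \<chi> l :: 4. 1/2 * (xi (dir l) \<bullet> v))"
    by (rule linear_conv_bounded_linear[THEN iffD1])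
      (auto intro!: linearI simp: vec_eq_iff inner_add_right algebra_simps)
  show "Ck_on k ?S (\<lambda>(U, \<epsilon>). lb_Q (\<lambda>u. 3 * D u) f U \<epsilon>)"
    unfolding eq
    by (rule Ck_on_bounded_bilinear[OF bounded_bilinear_scaleR rate]
        Ck_on_bounded_linear[OF bounded_linear_join]
        Ck_on_add[OF Ck_on_bounded_bilinear[OF bounded_bilinear_scaleR
            Ck_on_linear[OF bounded_linear_snd] Ck_on_bounded_linear[OF xi_lin Df(2)]]
          Ck_on_linear[OF bounded_linear_minus[OF
            bounded_linear_compose[OF bounded_linear_w_part bounded_linear_fst]]]])+
qed

lemma admissible_setting_lb:
  fixes f :: "real \<Rightarrow> real^2"
  assumes "open I" and "is_interval I"
    and "smooth_on I f" and "smooth_on I D" and "\<forall>u\<in>I. 0 < D u"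
  shows "admissible_setting {v. v $ 1 \<in> I} {U. u_part U \<in> {v. v $ 1 \<in> I}} lb_A (lb_Q (\<lambda>u. 3 * D u) f)"
    (is "admissible_setting ?\<Omega>u ?\<Omega> _ _")
proof -
  have lin: "linear (\<lambda>v :: real^1. v $ 1)"
    by (rule bounded_linear.linear[OF bounded_linear_vec_nth])
  have "open ?\<Omega>u"
    using open_vimage[OF \<open>open I\<close>, of "\<lambda>v :: real^1. v $ 1"]
    by (simp add: vimage_def continuous_on_component continuous_on_id)
  moreover have "convex ?\<Omega>u"
    using convex_linear_vimage[OF lin] assms(2) by (simp add: is_interval_convex_1 vimage_def)
  moreover have "open ?\<Omega>"
    using open_vimage[OF \<open>open I\<close>, of "\<lambda>U :: real^(1 + 4). U $ Inl 1"]
    by (simp add: u_part_def vimage_def continuous_on_component continuous_on_id)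
  moreover have "smooth_on (?\<Omega> \<times> {0..1}) (\<lambda>(U, \<epsilon>). lb_A j U \<epsilon>)" for j
    by (simp add: smooth_on_def lb_A_def Ck_on_const case_prod_beta')
  moreover have "smooth_on (?\<Omega> \<times> {0..1}) (\<lambda>(U, \<epsilon>). lb_Q (\<lambda>u. 3 * D u) f U \<epsilon>)"
    using assms by (intro smooth_on_lb_Q) (auto simp: u_part_def)
  ultimately show ?thesis
    by (simp add: admissible_setting_def)
qed

lemma smooth_on_imp_differentiable:
  assumes "smooth_on I F" and "open I" and "u \<in> I"
  shows "F differentiable (at u)"
proof -
  have "Ck_on (Suc 0) I F"
    using assms(1) unfolding smooth_on_def by blast
  then obtain F' where "\<forall>u\<in>I. (F has_derivative F' u) (at u within I)"
    by (elim Ck_on_SucE)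
  then show ?thesis
    using assms(2,3) by (metis at_within_open differentiable_def)
qed

lemma convergence_criteria_lb:
  fixes f :: "real \<Rightarrow> real^2"
  assumes "open I" and "smooth_on I f" and "smooth_on I D" and pos: "\<forall>u\<in>I. 0 < D u"
  shows "convergence_criteria {v. v $ 1 \<in> I} {U. u_part U \<in> {v. v $ 1 \<in> I}} lb_A (lb_Q (\<lambda>u. 3 * D u) f)"
    (is "convergence_criteria ?\<Omega>u ?\<Omega> _ ?Q")
proof -
  have "smooth_on (?\<Omega> \<times> {0..1}) (\<lambda>(U, \<epsilon>). ?Q U \<epsilon>)"
    using assms by (intro smooth_on_lb_Q) (auto simp: u_part_def)
  then have "smooth_on (?\<Omega> \<times> {0..1}) (\<lambda>(U, \<epsilon>). q_of ?Q U \<epsilon>)"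
    using Ck_on_bounded_linear[OF bounded_linear_w_part]
    unfolding smooth_on_def q_of_def case_prod_beta' by blast
  then have "criterion_i ?\<Omega> ?Q"
    by (simp add: criterion_i_def q_of_def lb_Q_def Let_def)
  moreover have "q_of ?Q (join u w) 0 = 0 \<longleftrightarrow> w = 0" if "u \<in> ?\<Omega>u" for u w
    using pos that by (auto simp: q_of_def lb_Q_def Let_def vec_eq_iff w_part_def)
  then have "criterion_ii ?\<Omega>u ?\<Omega> ?Q"
    using pos by (auto simp: criterion_ii_def dw_q_lb_Q intro!: matrix_inv_mat(1))
  moreover have "(\<lambda>u. 3 * D u) differentiable (at (u $ 1))" if "u \<in> ?\<Omega>u" for u
    using smooth_on_imp_differentiable[OF assms(3,1), of "u $ 1"] that by (intro derivative_intros) simp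
  then have "criterion_iv ?\<Omega>u ?Q (\<lambda>U \<epsilon>. block_matrix (mat 1) 0 0 lb_gram)"
    using pos by (intro criterion_iv_lb) auto
  ultimately show ?thesis
    unfolding convergence_criteria_def using criterion_iii_lb criterion_v_lb by blast
qed

section \<open>The limit equation\<close>

lemma deps_q_lb_Q:
  "deps_q (lb_Q \<tau> f) u = (\<chi> k. 1 / \<tau> (u $ 1) * (1/2 * (xi (dir k) \<bullet> f (u $ 1))))" (is "_ = ?c")
proof -
  have "(\<lambda>\<epsilon>. q_of (lb_Q \<tau> f) (join u 0) \<epsilon>) = (\<lambda>\<epsilon>. \<epsilon> *\<^sub>R ?c)"
    by (simp add: fun_eq_iff vec_eq_iff q_of_def w_part_def lb_Q_def Let_def)
  \<comment> \<open>At the endpoint 0 the derivative is one-sided; it is unique because the interval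
    is nondegenerate.\<close>
  moreover have "((\<lambda>\<epsilon>. \<epsilon> *\<^sub>R ?c) has_vector_derivative ?c) (at 0 within cbox 0 1)"
    by (auto intro!: derivative_eq_intros simp: has_vector_derivative_def)
  ultimately show ?thesis
    unfolding deps_q_def by (metis vector_derivative_within_cbox[of 0 1 0] cbox_interval
        atLeastAtMost_iff order_refl zero_le_one zero_less_one)
qed

lemma dw_A11_lb_A: "dw_A11 (lb_A j) u = (\<lambda>_. 0)"
  by (simp add: dw_A11_def)

lemma deps_A11_lb_A: "deps_A11 (lb_A j) u = 0"
  using vector_derivative_within_cbox[of 0 1 0 "\<lambda>_. 0" 0]
  by (simp add: deps_A11_def)

lemma blk12_lb_A_mult: "blk12 (lb_A j U \<epsilon>) *v w = vec (\<Sum>k\<in>UNIV. xi (dir k) $ j * w $ k)"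
  by (simp add: vec_eq_iff blk12_def lb_A_def matrix_vector_mult_def)

lemma blk21_lb_A_mult_vec: "blk21 (lb_A j U \<epsilon>) *v vec p = (\<chi> k. 1/6 * (xi (dir k) $ j * p))"
  by (simp add: vec_eq_iff blk21_def lb_A_def matrix_vector_mult_def)

text \<open>Isotropy: the 2 in \<open>sum_xi_xi_dir\<close> cancels the 1/2 in the components of
  w_1, so the first velocity moment of w_1 returns the vector it was made from.\<close>

lemma sum_xi_inner_xi: "(\<Sum>k\<in>UNIV. xi (dir k) $ j * (1/2 * (xi (dir k) \<bullet> v))) = v $ j"
proof -
  have "(\<Sum>k\<in>UNIV. xi (dir k) $ j * (1/2 * (xi (dir k) \<bullet> v)))
      = (\<Sum>k\<in>UNIV. \<Sum>i\<in>UNIV. 1/2 * v $ i * (xi (dir k) $ j * xi (dir k) $ i))"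
    by (simp add: inner_vec_def sum_distrib_left mult_ac)
  also have "\<dots> = (\<Sum>i\<in>UNIV. 1/2 * v $ i * (\<Sum>k\<in>UNIV. xi (dir k) $ j * xi (dir k) $ i))"
    by (subst sum.swap) (simp add: sum_distrib_left)
  also have "\<dots> = v $ j"
    by (simp add: sum_xi_xi_dir if_distrib cong: if_cong)
  finally show ?thesis .
qed

lemma limit_w1_lb:
  fixes u :: "real^2 \<Rightarrow> real \<Rightarrow> real"
  assumes "0 < D (u x t)" and u: "(\<lambda>y. u y t) differentiable (at x)"
  shows "limit_w1 lb_A (lb_Q (\<lambda>u. 3 * D u) f) (\<lambda>x t. vec (u x t)) x t
    = (\<chi> k. 1/2 * (xi (dir k) \<bullet> (f (u x t) - D (u x t) *\<^sub>R grad (\<lambda>y. u y t) x)))"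
proof -
  have "dx j (\<lambda>y. vec (u y t) :: real^1) x = vec (dx j (\<lambda>y. u y t) x)" for j
    using differentiable_along_axis[OF u] by (intro dx_linear) simp_all
  note dx = this
  have grad: "(\<Sum>j\<in>UNIV. blk21 (lb_A j (join (vec (u x t)) 0) 0) *v dx j (\<lambda>y. vec (u y t)) x)
      = (\<chi> k. 1/6 * (xi (dir k) \<bullet> grad (\<lambda>y. u y t) x))"
    unfolding dx blk21_lb_A_mult_vec
    by (simp add: vec_eq_iff grad_def inner_vec_def sum_divide_distrib)
  have mat: "mat c *v (v :: real^4) = c *\<^sub>R v" for c v
    by (simp add: vec_eq_iff mat_def matrix_vector_mult_def if_distrib[of "\<lambda>z. z * _"] cong: if_cong)
  have inv: "matrix_inv (mat (- (1 / (3 * D (u x t)))) :: real^4^4) = mat (- (3 * D (u x t)))"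
    using assms(1) by (subst matrix_inv_mat) simp_all
  show ?thesis
    unfolding limit_w1_def dw_q_lb_Q deps_q_lb_Q grad vec_component inv mat
    using assms(1) by (simp add: vec_eq_iff inner_diff_right field_simps)
qed

lemma Ck_on_2_imp_differentiable:
  fixes F :: "real^'d \<Rightarrow> real"
  assumes "Ck_on 2 UNIV F"
  shows "F differentiable (at x)" and "grad F differentiable (at x)"
proof -
  have "Ck_on (Suc (Suc 0)) UNIV F"
    using assms by (simp only: numeral_2_eq_2)
  then obtain F' where F': "\<forall>x\<in>UNIV. (F has_derivative F' x) (at x within UNIV)"
    and "\<forall>v. Ck_on (Suc 0) UNIV (\<lambda>x. F' x v)"
    by (elim Ck_on_SucE)
  then have F'_diff: "(\<lambda>x. F' x v) differentiable (at x)" for v x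
    using Ck_on_SucE[of 0 UNIV "\<lambda>x. F' x v"] by (metis UNIV_I differentiable_def)
  show "F differentiable (at x)"
    using F' by (auto simp: differentiable_def)
  have "dx j F y = F' y (axis j 1)" for j y
  proof -
    have "((\<lambda>s. y + s *\<^sub>R axis j 1) has_vector_derivative axis j 1) (at 0)"
      by (auto intro!: derivative_eq_intros)
    with F' show ?thesis
      unfolding dx_def
      using vector_derivative_diff_chain_within[of "\<lambda>s. y + s *\<^sub>R axis j 1" "axis j 1" 0 UNIV F "F' y"]
      by (intro vector_derivative_at) (simp add: o_def has_derivative_at_withinI)
  qed
  \<comment> \<open>\<open>Ck_on\<close> controls only one direction at a time; writing the gradient
    as a finite sum over the axes makes it differentiable as a vector field.\<close>
  then have "grad F = (\<lambda>y. \<Sum>j\<in>UNIV. F' y (axis j 1) *\<^sub>R axis j 1)"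
    by (simp add: fun_eq_iff grad_def vec_eq_iff axis_def if_distrib cong: if_cong)
  then show "grad F differentiable (at x)"
    by (auto intro!: differentiable_sum differentiable_scaleR F'_diff)
qed

lemma limit_equation_lb_iff:
  fixes u :: "real^2 \<Rightarrow> real \<Rightarrow> real"
  assumes I: "open I" and f: "smooth_on I f" and D: "smooth_on I D" and pos: "\<forall>u\<in>I. 0 < D u"
    and u_in: "\<And>y. u y t \<in> I" and u: "Ck_on 2 UNIV (\<lambda>y. u y t)" and ut: "u x differentiable (at t)"
  shows "limit_equation lb_A (lb_Q (\<lambda>u. 3 * D u) f) (\<lambda>x t. vec (u x t)) x t
    \<longleftrightarrow> convection_diffusion f D u x t"
proof -
  \<comment> \<open>The total flux, convective minus diffusive. As w_1 is a fixed linear image of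
    \<open>J\<close> at all points of space, one more space derivative passes through to
    \<open>J\<close>; this derivative of a gradient is where the second-order regularity of
    \<open>u\<close> enters.\<close>
  define J where "J y = f (u y t) - D (u y t) *\<^sub>R grad (\<lambda>z. u z t) y" for y
  let ?w1 = "\<lambda>v :: real^2. \<chi> k :: 4. 1/2 * (xi (dir k) \<bullet> v)"
  note diff_u = Ck_on_2_imp_differentiable[OF u]
  have diff: "(\<lambda>y. f (u y t)) differentiable (at x)"
    "(\<lambda>y. D (u y t) *\<^sub>R grad (\<lambda>z. u z t) y) differentiable (at x)"
    using smooth_on_imp_differentiable[OF f I u_in] smooth_on_imp_differentiable[OF D I u_in]
    by (auto intro!: differentiable_scaleR differentiable_compose[OF _ diff_u(1)] diff_u(2))
  note diffj = diff[THEN differentiable_along_axis]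
  have diffJ: "(\<lambda>s. J (x + s *\<^sub>R axis j 1)) differentiable (at 0)" for j
    unfolding J_def by (intro differentiable_diff diffj)

  have w1: "limit_w1 lb_A (lb_Q (\<lambda>u. 3 * D u) f) (\<lambda>x t. vec (u x t)) y t = ?w1 (J y)" for y
    using limit_w1_lb[of D u y t f] pos u_in diff_u(1) by (simp add: J_def)
  have "linear ?w1"
    by (rule linearI) (simp_all add: vec_eq_iff inner_add_right distrib_left)
  then have dx_w1: "dx j (\<lambda>y. ?w1 (J y)) x = ?w1 (dx j J x)" for j
    using diffJ by (rule dx_linear)
  have flux: "blk12 (lb_A j U \<epsilon>) *v dx j (\<lambda>y. ?w1 (J y)) x = vec (dx j J x $ j)" for j U \<epsilon>
    unfolding dx_w1 blk12_lb_A_mult by (simp only: vec_lambda_beta sum_xi_inner_xi)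

  have component: "dx j (\<lambda>y. G y $ j) x = dx j G x $ j"
    if "(\<lambda>s. G (x + s *\<^sub>R axis j 1)) differentiable (at 0)" for G :: "real^2 \<Rightarrow> real^2" and j
    using that by (intro dx_linear) (rule bounded_linear.linear[OF bounded_linear_vec_nth])
  have "dx j J x = dx j (\<lambda>y. f (u y t)) x - dx j (\<lambda>y. D (u y t) *\<^sub>R grad (\<lambda>z. u z t) y) x" for j
    unfolding dx_def J_def
    by (intro vector_derivative_at has_vector_derivative_diff
        vector_derivative_works[THEN iffD1] diffj)
  then have div_J: "(\<Sum>j\<in>UNIV. dx j J x $ j)
      = div_op (\<lambda>y. f (u y t)) x - div_op (\<lambda>y. D (u y t) *\<^sub>R grad (\<lambda>z. u z t) y) x"
    unfolding div_op_def component[OF diffj(1)] component[OF diffj(2)]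
    by (simp add: sum_subtractf)

  have "dt (\<lambda>x t. vec (u x t) :: real^1) x t = vec (dt u x t)"
    using ut by (intro dt_linear) simp_all
  moreover have "(\<Sum>j\<in>UNIV. vec (dx j J x $ j)) = (vec (\<Sum>j\<in>UNIV. dx j J x $ j) :: real^1)"
    by (simp add: vec_eq_iff)
  ultimately show ?thesis
    unfolding limit_equation_def w1 flux dw_A11_lb_A deps_A11_lb_A convection_diffusion_def
    by (simp add: div_J vec_eq_iff) linarith
qed

theorem mainTheorem6:
  fixes I :: "real set" and f :: "real \<Rightarrow> real^2" and D \<tau> :: "real \<Rightarrow> real"
    and \<Omega>u :: "(real^1) set" and \<Omega> :: "(real^(1 + 4)) set"
  assumes "open I" and "is_interval I"
    and "smooth_on I f" and "smooth_on I D" and "\<forall>u\<in>I. 0 < D u"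
    and \<tau>: "\<tau> = (\<lambda>u. 3 * D u)"
    and \<Omega>u: "\<Omega>u = {v. v $ 1 \<in> I}" and \<Omega>: "\<Omega> = {U. u_part U \<in> \<Omega>u}"
  shows
    "bij lb_vars
     \<and> (\<forall>\<epsilon> g x t. 0 < \<epsilon> \<and> \<epsilon> \<le> 1 \<and> (\<lambda>(x, t). g x t) differentiable (at (x, t))
            \<and> lb_vars (g x t) \<in> \<Omega> \<longrightarrow>
          (lb_equation \<tau> f \<epsilon> g x t \<longleftrightarrow> lb_uh_equations \<tau> f \<epsilon> (\<lambda>x t. lb_vars (g x t)) x t))
     \<and> (\<forall>\<epsilon> U x t. 0 < \<epsilon> \<and> \<epsilon> \<le> 1 \<and> (\<lambda>(x, t). U x t) differentiable (at (x, t))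
            \<and> U x t \<in> \<Omega> \<longrightarrow>
          (lb_uh_equations \<tau> f \<epsilon> U x t \<longleftrightarrow> relaxation_system lb_A (lb_Q \<tau> f) \<epsilon> U x t))
     \<and> admissible_setting \<Omega>u \<Omega> lb_A (lb_Q \<tau> f)
     \<and> convergence_criteria \<Omega>u \<Omega> lb_A (lb_Q \<tau> f)
     \<and> (\<forall>u x t. (\<forall>y. u y t \<in> I) \<and> Ck_on 2 UNIV (\<lambda>y. u y t) \<and> u x differentiable (at t) \<longrightarrow>
          (limit_equation lb_A (lb_Q \<tau> f) (\<lambda>x t. vec (u x t)) x t \<longleftrightarrow>
           convection_diffusion f D u x t))"
  unfolding \<Omega> \<Omega>u \<tau>
  using assms(1-5)
  by (intro conjI allI impI bij_lb_vars lb_equation_iff_lb_uh_equations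
      lb_uh_equations_iff_relaxation_system admissible_setting_lb convergence_criteria_lb
      limit_equation_lb_iff[where I = I]) blast+

end
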